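(* Let $\mathcal{A}$ be a finite category and assume that $\chi_{Lein}(\mathcal{A})$ is defined. Then $$\chi_{Lein}(\mathcal{A})=\chi(\mathcal{A}).$$
   Context: A finite category is a category with finitely many objects and finitely many morphisms. All matrices have entries in $\mathbb{Q}$, and $M^*$ denotes the transpose of $M$. The Moore–Penrose inverse of an $m\times n$-matrix $M$ is the unique $n\times m$-matrix $M^+$ satisfying $MM^+M=M$, $M^+MM^+=M^+$, $(M^+M)^*=M^+M$, $(MM^+)^*=MM^+$. $\mathbf{1}_m$ denotes the $m\times 1$-matrix all of whose entries are $1$. For a finite category $\mathcal{A}$ with object set $\{a_1,\dots,a_m\}$, $|\mathcal{A}|=m$ is the number of objects and $[\mathcal{A}]$ is the $m\times m$-matrix whose $ij$-th entry is the number of elements of the morphism set $\mathcal{A}(a_i,a_j)$. Define $\chi(\mathcal{A})=\mathbf{1}_{|\mathcal{A}|}^*[\mathcal{A}]^+\mathbf{1}_{|\mathcal{A}|}$, a $1\times 1$-matrix regarded as a rational number (independent of the order of the objects). An $n\times 1$-matrix $w$ is a weighting for an $m\times n$-matrix $M$ if $Mw=\mathbf{1}_m$; a $1\times m$-matrix $v$ is a coweighting for $M$ if $vM=\mathbf{1}_n^*$. Leinster's Euler characteristic $\chi_{Lein}(\mathcal{A})$ is defined exactly when $[\mathcal{A}]$ has both a weighting and a coweighting, and in that case $\chi_{Lein}(\mathcal{A})=\mathbf{1}_{|\mathcal{A}|}^*w$ (the sum of the entries of $w$) for any weighting $w$ of $[\mathcal{A}]$; this does not depend on the choice of $w$. 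*)

theory Defs
  imports Complex_Main "Jordan_Normal_Form.Matrix"
begin

text \<open>
  \<open>Comp A g f\<close> is \<open>g\<close> after \<open>f\<close>. All operations are only constrained on \<open>Obj A\<close> and \<open>Arr A\<close>.
\<close>

record ('o, 'a) cat_data =
  Obj :: "'o set"
  Arr :: "'a set"
  Dom :: "'a \<Rightarrow> 'o"
  Cod :: "'a \<Rightarrow> 'o"
  Ident :: "'o \<Rightarrow> 'a"
  Comp :: "'a \<Rightarrow> 'a \<Rightarrow> 'a"

definition Hom :: "('o, 'a) cat_data \<Rightarrow> 'o \<Rightarrow> 'o \<Rightarrow> 'a set" where
  "Hom A a b = {f \<in> Arr A. Dom A f = a \<and> Cod A f = b}"

locale category =
  fixes A :: "('o, 'a) cat_data"
  assumes dom_in_obj: "f \<in> Arr A \<Longrightarrow> Dom A f \<in> Obj A"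
    and cod_in_obj: "f \<in> Arr A \<Longrightarrow> Cod A f \<in> Obj A"
    and ident_in_hom: "a \<in> Obj A \<Longrightarrow> Ident A a \<in> Hom A a a"
    and comp_in_hom: "f \<in> Hom A a b \<Longrightarrow> g \<in> Hom A b c \<Longrightarrow> Comp A g f \<in> Hom A a c"
    and comp_ident_right: "f \<in> Hom A a b \<Longrightarrow> Comp A f (Ident A a) = f"
    and comp_ident_left: "f \<in> Hom A a b \<Longrightarrow> Comp A (Ident A b) f = f"
    and comp_assoc: "f \<in> Hom A a b \<Longrightarrow> g \<in> Hom A b c \<Longrightarrow> h \<in> Hom A c d \<Longrightarrow>
      Comp A h (Comp A g f) = Comp A (Comp A h g) f"

locale finite_category = category A
  for A :: "('o, 'a) cat_data" +
  assumes finite_obj: "finite (Obj A)"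
    and finite_arr: "finite (Arr A)"

definition is_moore_penrose :: "rat mat \<Rightarrow> rat mat \<Rightarrow> bool" where
  "is_moore_penrose M X \<longleftrightarrow>
     X \<in> carrier_mat (dim_col M) (dim_row M) \<and>
     M * X * M = M \<and>
     X * M * X = X \<and>
     transpose_mat (X * M) = X * M \<and>
     transpose_mat (M * X) = M * X"

definition moore_penrose :: "rat mat \<Rightarrow> rat mat" where
  "moore_penrose M = (THE X. is_moore_penrose M X)"

definition ones :: "nat \<Rightarrow> rat mat" where
  "ones m = mat m 1 (\<lambda>_. 1)"

definition weighting :: "rat mat \<Rightarrow> rat mat \<Rightarrow> bool" where
  "weighting M w \<longleftrightarrow> w \<in> carrier_mat (dim_col M) 1 \<and> M * w = ones (dim_row M)"

definition coweighting :: "rat mat \<Rightarrow> rat mat \<Rightarrow> bool" where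
  "coweighting M v \<longleftrightarrow>
     v \<in> carrier_mat 1 (dim_row M) \<and> v * M = transpose_mat (ones (dim_col M))"

definition obj_enum :: "('o, 'a) cat_data \<Rightarrow> 'o list \<Rightarrow> bool" where
  "obj_enum A as \<longleftrightarrow> distinct as \<and> set as = Obj A"

definition hom_matrix :: "('o, 'a) cat_data \<Rightarrow> 'o list \<Rightarrow> rat mat" where
  "hom_matrix A as =
     mat (length as) (length as) (\<lambda>(i, j). of_nat (card (Hom A (as ! i) (as ! j))))"

text \<open>
  The quantities below do not depend on the enumeration of the objects (nor on the choice of
  weighting), so each is the unique value obtained from some such choice. The index \<open>(0, 0)\<close>
  reads a \<open>1 \<times> 1\<close> matrix as a rational number.
\<close>

definition euler_char :: "('o, 'a) cat_data \<Rightarrow> rat" where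
  "euler_char A = (THE x. \<exists>as. obj_enum A as \<and>
     x = (transpose_mat (ones (card (Obj A))) * moore_penrose (hom_matrix A as)
            * ones (card (Obj A))) $$ (0, 0))"

definition leinster_defined :: "('o, 'a) cat_data \<Rightarrow> bool" where
  "leinster_defined A \<longleftrightarrow> (\<exists>as. obj_enum A as \<and>
     (\<exists>w. weighting (hom_matrix A as) w) \<and> (\<exists>v. coweighting (hom_matrix A as) v))"

text \<open>Only meaningful under \<open>leinster_defined A\<close>.\<close>

definition leinster_char :: "('o, 'a) cat_data \<Rightarrow> rat" where
  "leinster_char A = (THE x. \<exists>as w. obj_enum A as \<and> weighting (hom_matrix A as) w \<and>
     x = (transpose_mat (ones (card (Obj A))) * w) $$ (0, 0))"

end

theory Submission
  imports Defs
begin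

text \<open>
  Let \<open>M\<close> be the hom matrix of some enumeration of the objects, with weighting \<open>w\<close> and
  coweighting \<open>v\<close>, so that \<open>M w = 1\<close> and \<open>v M = 1\<^sup>T\<close>. Both Euler characteristics equal \<open>v M w\<close>:
  on the one hand \<open>1\<^sup>T w = v M w\<close>, on the other \<open>1\<^sup>T M\<^sup>+ 1 = v (M M\<^sup>+ M) w = v M w\<close>.

  Since \<open>M\<^sup>+\<close> is introduced by a definite description, the Moore--Penrose inverse must be shown
  to exist and to be unique. Existence over an ordered field rests on least squares: by
  Gram--Schmidt the normal equations \<open>M\<^sup>T (b - M x) = 0\<close> are solvable for every \<open>b\<close>, so there is
  a matrix \<open>X\<close> with \<open>M\<^sup>T M X = M\<^sup>T\<close>. Such an \<open>X\<close> satisfies \<open>M X M = M\<close> and makes \<open>M X\<close> symmetric.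
  The same construction for \<open>M\<^sup>T\<close> makes the product on the other side symmetric, and the two are
  combined into the Moore--Penrose inverse.

  The two characteristics are also defined as the common value over all enumerations of the
  objects. To compare enumerations, weightings and coweightings are regarded as functions on
  objects, where no enumeration is involved: the sum of the entries of any weighting, for any
  enumeration, equals the total of one fixed coweighting function.
\<close>

section \<open>Least squares\<close>

text \<open>
  One Gram--Schmidt step. Let \<open>r\<close> and \<open>s\<close> be the residuals of the new vector \<open>c n\<close> and of \<open>b\<close>
  after projection to the span of the earlier vectors. If \<open>r\<close> vanishes then \<open>c n\<close> lies in that span
  and nothing has to be changed; otherwise a multiple of \<open>r\<close> is subtracted from \<open>s\<close>. The multiple
  exists because \<open>\<langle>c n, r\<rangle> = \<langle>r, r\<rangle>\<close> is positive; this is where the order on the field enters.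
\<close>

lemma normal_equations_solvable:
  fixes c :: "nat \<Rightarrow> 'i \<Rightarrow> 'a::linordered_field"
  assumes I: "finite I"
  shows "\<exists>x. \<forall>i<n. (\<Sum>k\<in>I. c i k * (b k - (\<Sum>j<n. x j * c j k))) = 0"
proof (induction n arbitrary: b)
  case 0
  show ?case by simp
next
  case (Suc n)
  obtain x where x: "\<forall>i<n. (\<Sum>k\<in>I. c i k * (b k - (\<Sum>j<n. x j * c j k))) = 0"
    using Suc.IH by blast
  obtain y where y: "\<forall>i<n. (\<Sum>k\<in>I. c i k * (c n k - (\<Sum>j<n. y j * c j k))) = 0"
    using Suc.IH by blast
  define s where "s k = b k - (\<Sum>j<n. x j * c j k)" for k
  define r where "r k = c n k - (\<Sum>j<n. y j * c j k)" for k
  have s: "(\<Sum>k\<in>I. c i k * s k) = 0" if "i < n" for i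
    using x that by (simp add: s_def)
  have r: "(\<Sum>k\<in>I. c i k * r k) = 0" if "i < n" for i
    using y that by (simp add: r_def)
  have new_inner: "(\<Sum>k\<in>I. c n k * u k) = (\<Sum>k\<in>I. r k * u k)"
    if "\<And>i. i < n \<Longrightarrow> (\<Sum>k\<in>I. c i k * u k) = 0" for u
  proof -
    have "(\<Sum>k\<in>I. (\<Sum>j<n. y j * c j k) * u k) = (\<Sum>j<n. y j * (\<Sum>k\<in>I. c j k * u k))"
      by (simp add: sum_distrib_left sum_distrib_right mult.assoc) (rule sum.swap)
    also have "\<dots> = 0"
      using that by simp
    finally show ?thesis
      by (simp add: r_def left_diff_distrib sum_subtractf)
  qed
  have "\<exists>t. (\<Sum>k\<in>I. c n k * (s k - t * r k)) = 0"
  proof (cases "\<forall>k\<in>I. r k = 0")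
    case True
    then have "(\<Sum>k\<in>I. c n k * (s k - 0 * r k)) = 0"
      using new_inner[OF s] by simp
    then show ?thesis ..
  next
    case False
    then have "(\<Sum>k\<in>I. r k * r k) \<noteq> 0"
      using I by (simp add: sum_nonneg_eq_0_iff)
    then have nz: "(\<Sum>k\<in>I. c n k * r k) \<noteq> 0"
      using new_inner[OF r] by simp
    define t where "t = (\<Sum>k\<in>I. c n k * s k) / (\<Sum>k\<in>I. c n k * r k)"
    have "(\<Sum>k\<in>I. c n k * (s k - t * r k))
        = (\<Sum>k\<in>I. c n k * s k) - t * (\<Sum>k\<in>I. c n k * r k)"
      by (simp add: algebra_simps sum_subtractf sum_distrib_left)
    also have "\<dots> = 0"
      using nz by (simp add: t_def)
    finally show ?thesis ..
  qed
  then obtain t where t: "(\<Sum>k\<in>I. c n k * (s k - t * r k)) = 0" ..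
  have orth: "(\<Sum>k\<in>I. c i k * (s k - t * r k)) = 0" if "i < Suc n" for i
  proof (cases "i = n")
    case True
    then show ?thesis using t by simp
  next
    case False
    then have "i < n" using that by simp
    have "(\<Sum>k\<in>I. c i k * (s k - t * r k))
        = (\<Sum>k\<in>I. c i k * s k) - t * (\<Sum>k\<in>I. c i k * r k)"
      by (simp add: algebra_simps sum_subtractf sum_distrib_left)
    then show ?thesis
      using s[OF \<open>i < n\<close>] r[OF \<open>i < n\<close>] by simp
  qed
  \<comment> \<open>the coefficients of \<open>b - (s - t r)\<close> in terms of \<open>c 0, \<dots>, c n\<close>\<close>
  define z where "z j = (if j = n then t else x j - t * y j)" for j
  have "b k - (\<Sum>j<Suc n. z j * c j k) = s k - t * r k" for k
    by (simp add: z_def s_def r_def algebra_simps sum_subtractf sum_distrib_left)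
  then show ?case
    using orth by (intro exI[of _ z]) simp
qed

text \<open>
  The columns of \<open>X\<close> are solutions of the normal equations for the standard basis vectors.
\<close>

lemma normal_equations_matrix:
  fixes M :: "'a::linordered_field mat"
  assumes M: "M \<in> carrier_mat m n"
  shows "\<exists>X\<in>carrier_mat n m. transpose_mat M * (M * X) = transpose_mat M"
proof -
  define e :: "nat \<Rightarrow> nat \<Rightarrow> 'a" where "e l k = (if k = l then 1 else 0)" for l k
  define solves where "solves l x \<longleftrightarrow>
      (\<forall>i<n. (\<Sum>k<m. M $$ (k, i) * (e l k - (\<Sum>j<n. x j * M $$ (k, j)))) = 0)" for l x
  have "\<forall>l. \<exists>x. solves l x"
    using normal_equations_solvable[of "{..<m}" n "\<lambda>j k. M $$ (k, j)" "e _"]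
    unfolding solves_def by simp
  then obtain x where sol: "\<forall>l. solves l (x l)"
    by (rule choice[THEN exE])
  have x: "(\<Sum>k<m. M $$ (k, i) * (e l k - (\<Sum>j<n. x l j * M $$ (k, j)))) = 0"
    if "i < n" for l i
    using sol that by (simp add: solves_def)
  define X where "X = mat n m (\<lambda>(j, l). x l j)"
  have "transpose_mat M * (M * X) = transpose_mat M"
  proof (rule eq_matI)
    fix i l
    assume "i < dim_row (transpose_mat M)" and "l < dim_col (transpose_mat M)"
    then have il: "i < n" "l < m"
      using M by auto
    have "(\<Sum>k<m. M $$ (k, i) * e l k) = M $$ (l, i)"
      using il by (simp add: e_def if_distrib cong: if_cong)
    then show "(transpose_mat M * (M * X)) $$ (i, l) = transpose_mat M $$ (i, l)"
      using M il x[OF il(1), of l]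
      by (simp add: X_def scalar_prod_def lessThan_atLeast0 right_diff_distrib sum_subtractf
          mult.commute[of _ "x _ _"])
  qed (use M in \<open>auto simp: X_def\<close>)
  moreover have "X \<in> carrier_mat n m"
    by (simp add: X_def)
  ultimately show ?thesis by blast
qed

section \<open>The Moore--Penrose inverse\<close>

text \<open>
  Transposing \<open>M\<^sup>T M X = M\<^sup>T\<close> gives \<open>(M X)\<^sup>T M = M\<close>. Multiplying the former by \<open>X\<^sup>T\<close>
  gives \<open>(M X)\<^sup>T (M X) = (M X)\<^sup>T\<close>, whose left side is symmetric.
\<close>

lemma least_squares_inverse_exists:
  fixes M :: "'a::linordered_field mat"
  assumes M: "M \<in> carrier_mat m n"
  shows "\<exists>X\<in>carrier_mat n m. M * X * M = M \<and> transpose_mat (M * X) = M * X"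
proof -
  obtain X where X: "X \<in> carrier_mat n m"
    and eq: "transpose_mat M * (M * X) = transpose_mat M"
    using normal_equations_matrix[OF M] by blast
  have MX: "M * X \<in> carrier_mat m m"
    using M X by simp
  have tM: "transpose_mat M \<in> carrier_mat n m" and tX: "transpose_mat X \<in> carrier_mat m n"
    using M X by auto
  have tMX: "transpose_mat (M * X) = transpose_mat X * transpose_mat M"
    using transpose_mult[OF M X] .
  have "transpose_mat (M * X) * (M * X) = transpose_mat (M * X)"
    using assoc_mult_mat[OF tX tM MX] by (simp add: tMX eq)
  moreover have "transpose_mat (transpose_mat (M * X) * (M * X)) = transpose_mat (M * X) * (M * X)"
    using transpose_mult[of "transpose_mat (M * X)" m m "M * X" m] MX by simp
  ultimately have sym: "transpose_mat (M * X) = M * X"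
    by (metis transpose_transpose)
  have "transpose_mat (M * X) * M = M"
    using transpose_mult[OF tM MX] eq by simp
  then have "M * X * M = M"
    by (simp add: sym)
  then show ?thesis
    using X sym by blast
qed

text \<open>
  If \<open>M X\<close> and \<open>Y M\<close> are symmetric for two generalised inverses \<open>X\<close> and \<open>Y\<close> of \<open>M\<close>, then
  \<open>Y M X\<close> inherits both symmetries, since \<open>M (Y M X) = M X\<close> and \<open>(Y M X) M = Y M\<close>.
\<close>

lemma moore_penrose_exists: "\<exists>X. is_moore_penrose M X"
proof -
  define m n where "m = dim_row M" and "n = dim_col M"
  have M: "M \<in> carrier_mat m n"
    by (simp add: m_def n_def)
  have tM: "transpose_mat M \<in> carrier_mat n m"
    using M by simp
  obtain X where X: "X \<in> carrier_mat n m"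
    and MXM: "M * X * M = M" and symX: "transpose_mat (M * X) = M * X"
    using least_squares_inverse_exists[OF M] by blast
  obtain Z where Z: "Z \<in> carrier_mat m n"
    and MZM: "transpose_mat M * Z * transpose_mat M = transpose_mat M"
    and symZ: "transpose_mat (transpose_mat M * Z) = transpose_mat M * Z"
    using least_squares_inverse_exists[OF tM] by blast
  define Y where "Y = transpose_mat Z"
  have Y: "Y \<in> carrier_mat n m"
    using Z by (simp add: Y_def)
  have YM: "transpose_mat M * Z = Y * M"
    using symZ transpose_mult[OF tM Z] by (simp add: Y_def)
  then have symY: "transpose_mat (Y * M) = Y * M"
    using symZ by simp
  have "transpose_mat (Y * M * transpose_mat M) = M"
    using MZM by (simp add: YM)
  then have "M * (Y * M) = M"
    using transpose_mult[of "Y * M" n n "transpose_mat M" m] M Y by (simp add: symY)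
  then have MYM: "M * Y * M = M"
    using assoc_mult_mat[OF M Y M] by simp
  define W where "W = Y * M * X"
  have W: "W \<in> carrier_mat n m"
    using X Y by (auto simp: W_def)
  have MW: "M * W = M * X"
  proof -
    have "M * W = M * (Y * M) * X"
      unfolding W_def using M X Y by (intro assoc_mult_mat[symmetric]) auto
    also have "\<dots> = M * X"
      using assoc_mult_mat[OF M Y M] by (simp add: MYM)
    finally show ?thesis .
  qed
  have WM: "W * M = Y * M"
  proof -
    have "W * M = Y * (M * X) * M"
      unfolding W_def using assoc_mult_mat[OF Y M X] by simp
    also have "\<dots> = Y * (M * X * M)"
      using M X Y by (intro assoc_mult_mat) auto
    finally show ?thesis
      by (simp add: MXM)
  qed
  have "W * M * W = Y * (M * W)"
    unfolding WM by (rule assoc_mult_mat[OF Y M W])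
  also have "\<dots> = W"
    unfolding MW using assoc_mult_mat[OF Y M X] by (simp add: W_def)
  finally have "W * M * W = W" .
  then have "is_moore_penrose M W"
    unfolding is_moore_penrose_def
    using W MW WM MXM symX symY by (simp add: m_def n_def)
  then show ?thesis ..
qed

text \<open>
  The product \<open>M X\<close> is the orthogonal projection onto the column space of \<open>M\<close>, and so it does
  not depend on \<open>X\<close>.
\<close>

lemma column_projection_unique:
  fixes M :: "'a::comm_semiring_1 mat"
  assumes M: "M \<in> carrier_mat m n" and X: "X \<in> carrier_mat n m" and Y: "Y \<in> carrier_mat n m"
    and MXM: "M * X * M = M" and symX: "transpose_mat (M * X) = M * X"
    and MYM: "M * Y * M = M" and symY: "transpose_mat (M * Y) = M * Y"
  shows "M * X = M * Y"
proof -
  have P: "M * X \<in> carrier_mat m m" and Q: "M * Y \<in> carrier_mat m m"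
    using M X Y by auto
  have QP: "(M * Y) * (M * X) = M * X"
    using assoc_mult_mat[OF Q M X] by (simp add: MYM)
  have PQ: "(M * X) * (M * Y) = M * Y"
    using assoc_mult_mat[OF P M Y] by (simp add: MXM)
  have "M * X = transpose_mat ((M * Y) * (M * X))"
    by (simp add: QP symX)
  also have "\<dots> = (M * X) * (M * Y)"
    using transpose_mult[OF Q P] by (simp add: symX symY)
  finally show ?thesis
    by (simp add: PQ)
qed

text \<open>
  Uniqueness of the column projection, used for \<open>M\<close> and for \<open>M\<^sup>T\<close>, shows that two
  Moore--Penrose inverses \<open>X\<close> and \<open>Y\<close> satisfy \<open>M X = M Y\<close> and \<open>X M = Y M\<close>; hence
  \<open>X = X M X = Y M X = Y M Y = Y\<close>.
\<close>

lemma moore_penrose_unique: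
  assumes "is_moore_penrose M X" and "is_moore_penrose M Y"
  shows "X = Y"
proof -
  define m n where "m = dim_row M" and "n = dim_col M"
  have M: "M \<in> carrier_mat m n"
    by (simp add: m_def n_def)
  have X: "X \<in> carrier_mat n m" and Y: "Y \<in> carrier_mat n m"
    using assms by (auto simp: is_moore_penrose_def m_def n_def)
  have MX: "M * X = M * Y"
    using assms by (intro column_projection_unique[OF M X Y]) (auto simp: is_moore_penrose_def)
  have tr: "transpose_mat (N * M) = transpose_mat M * transpose_mat N"
    if "N \<in> carrier_mat n m" for N
    using transpose_mult[OF that M] .
  have inv: "transpose_mat M * transpose_mat N * transpose_mat M = transpose_mat M
      \<and> transpose_mat (transpose_mat M * transpose_mat N) = transpose_mat M * transpose_mat N"
    if "is_moore_penrose M N" and N: "N \<in> carrier_mat n m" for N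
  proof -
    have "transpose_mat (M * (N * M)) = transpose_mat (N * M) * transpose_mat M"
      using M N by (intro transpose_mult) auto
    moreover have "M * (N * M) = M"
      using that assoc_mult_mat[OF M N M] by (simp add: is_moore_penrose_def)
    moreover have "transpose_mat (N * M) = N * M"
      using that by (simp add: is_moore_penrose_def)
    ultimately show ?thesis
      using tr[OF N] by simp
  qed
  have "transpose_mat M * transpose_mat X = transpose_mat M * transpose_mat Y"
    using inv[OF assms(1) X] inv[OF assms(2) Y] M X Y
    by (intro column_projection_unique[of _ n m]) auto
  then have XM: "X * M = Y * M"
    using assms tr[OF X] tr[OF Y] by (simp add: is_moore_penrose_def)
  have "X = Y * M * X"
    using assms(1) XM by (simp add: is_moore_penrose_def)
  also have "\<dots> = Y * M * Y"
    using assoc_mult_mat[OF Y M X] assoc_mult_mat[OF Y M Y] by (simp add: MX)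
  also have "\<dots> = Y"
    using assms(2) by (simp add: is_moore_penrose_def)
  finally show ?thesis .
qed

lemma is_moore_penrose_moore_penrose: "is_moore_penrose M (moore_penrose M)"
  unfolding moore_penrose_def
  using moore_penrose_exists moore_penrose_unique by (metis theI)

text \<open>
  With \<open>ones m = M w\<close> and \<open>(ones n)\<^sup>T = v M\<close>, both sides become \<open>v M w\<close>.
\<close>

lemma moore_penrose_sum_eq_weighting_sum:
  assumes M: "M \<in> carrier_mat m n" and w: "weighting M w" and v: "coweighting M v"
  shows "transpose_mat (ones n) * moore_penrose M * ones m = transpose_mat (ones n) * w"
proof -
  let ?X = "moore_penrose M"
  have X: "?X \<in> carrier_mat n m" and MXM: "M * ?X * M = M"
    using is_moore_penrose_moore_penrose[of M] M by (auto simp: is_moore_penrose_def)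
  have w1: "w \<in> carrier_mat n 1" and Mw: "ones m = M * w"
    using w M by (auto simp: weighting_def)
  have v1: "v \<in> carrier_mat 1 m" and vM: "transpose_mat (ones n) = v * M"
    using v M by (auto simp: coweighting_def)
  have "v * M * ?X * (M * w) = v * (M * ?X) * (M * w)"
    using assoc_mult_mat[OF v1 M X] by simp
  also have "\<dots> = v * (M * ?X) * M * w"
    using v1 M X w1 by (intro assoc_mult_mat[symmetric]) auto
  also have "v * (M * ?X) * M = v * (M * ?X * M)"
    using v1 M X by (intro assoc_mult_mat) auto
  finally show ?thesis
    by (simp add: MXM Mw vM)
qed

section \<open>Weightings as functions on objects\<close>

definition obj_weighting :: "('o, 'a) cat_data \<Rightarrow> ('o \<Rightarrow> rat) \<Rightarrow> bool" where
  "obj_weighting A k \<longleftrightarrow>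
     (\<forall>a\<in>Obj A. (\<Sum>b\<in>Obj A. of_nat (card (Hom A a b)) * k b) = 1)"

definition obj_coweighting :: "('o, 'a) cat_data \<Rightarrow> ('o \<Rightarrow> rat) \<Rightarrow> bool" where
  "obj_coweighting A l \<longleftrightarrow>
     (\<forall>b\<in>Obj A. (\<Sum>a\<in>Obj A. l a * of_nat (card (Hom A a b))) = 1)"

text \<open>
  Both sides equal the double sum of \<open>l a * card (Hom A a b) * k b\<close>.
\<close>

lemma obj_weighting_sum_eq_coweighting_sum:
  assumes "obj_weighting A k" and "obj_coweighting A l"
  shows "(\<Sum>b\<in>Obj A. k b) = (\<Sum>a\<in>Obj A. l a)"
proof -
  have "(\<Sum>b\<in>Obj A. k b)
      = (\<Sum>b\<in>Obj A. (\<Sum>a\<in>Obj A. l a * of_nat (card (Hom A a b))) * k b)"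
    using assms(2) by (simp add: obj_coweighting_def)
  also have "\<dots> = (\<Sum>a\<in>Obj A. l a * (\<Sum>b\<in>Obj A. of_nat (card (Hom A a b)) * k b))"
    by (simp add: sum_distrib_left sum_distrib_right mult.assoc) (rule sum.swap)
  also have "\<dots> = (\<Sum>a\<in>Obj A. l a)"
    using assms(1) by (simp add: obj_weighting_def)
  finally show ?thesis .
qed

lemma obj_enum_bij_betw:
  assumes "obj_enum A as"
  shows "bij_betw (\<lambda>i. as ! i) {..<length as} (Obj A)"
  using assms by (simp add: obj_enum_def bij_betw_nth)

lemma obj_enum_length:
  assumes "obj_enum A as"
  shows "length as = card (Obj A)"
  using assms by (metis obj_enum_def distinct_card)

lemma obj_enum_all:
  assumes "obj_enum A as"
  shows "(\<forall>i<length as. P (as ! i)) \<longleftrightarrow> (\<forall>a\<in>Obj A. P a)"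
  using assms by (auto simp: obj_enum_def all_set_conv_all_nth[of as P, symmetric])

lemma obj_enum_sum:
  assumes "obj_enum A as"
  shows "(\<Sum>i<length as. f (as ! i)) = (\<Sum>a\<in>Obj A. f a)"
  using sum.reindex_bij_betw[OF obj_enum_bij_betw[OF assms]] .

lemma obj_enum_inverse:
  assumes "obj_enum A as"
  obtains p where "\<And>i. i < length as \<Longrightarrow> p (as ! i) = i"
  using inv_into_f_f[of "\<lambda>i. as ! i" "{..<length as}"] obj_enum_bij_betw[OF assms]
  by (metis bij_betw_imp_inj_on lessThan_iff)

lemma hom_matrix_carrier: "hom_matrix A as \<in> carrier_mat (length as) (length as)"
  by (simp add: hom_matrix_def)

lemma weighting_hom_matrix_iff:
  assumes as: "obj_enum A as" and w: "w \<in> carrier_mat (length as) 1"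
    and k: "\<And>i. i < length as \<Longrightarrow> w $$ (i, 0) = k (as ! i)"
  shows "weighting (hom_matrix A as) w \<longleftrightarrow> obj_weighting A k"
proof -
  have row: "(hom_matrix A as * w) $$ (i, 0)
      = (\<Sum>b\<in>Obj A. of_nat (card (Hom A (as ! i) b)) * k b)" if "i < length as" for i
    using that w
    by (simp add: hom_matrix_def scalar_prod_def lessThan_atLeast0[symmetric] k
        obj_enum_sum[OF as, of "\<lambda>b. of_nat (card (Hom A (as ! i) b)) * k b"])
  have "weighting (hom_matrix A as) w
      \<longleftrightarrow> (\<forall>i<length as. (hom_matrix A as * w) $$ (i, 0) = 1)"
    using w by (auto simp: weighting_def hom_matrix_def ones_def mat_eq_iff simp del: index_mult_mat(1))
  also have "\<dots> \<longleftrightarrow> (\<forall>i<length as. (\<Sum>b\<in>Obj A. of_nat (card (Hom A (as ! i) b)) * k b) = 1)"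
    using row by simp
  also have "\<dots> \<longleftrightarrow> obj_weighting A k"
    unfolding obj_weighting_def by (rule obj_enum_all[OF as])
  finally show ?thesis .
qed

lemma coweighting_hom_matrix_iff:
  assumes as: "obj_enum A as" and v: "v \<in> carrier_mat 1 (length as)"
    and l: "\<And>i. i < length as \<Longrightarrow> v $$ (0, i) = l (as ! i)"
  shows "coweighting (hom_matrix A as) v \<longleftrightarrow> obj_coweighting A l"
proof -
  have col: "(v * hom_matrix A as) $$ (0, j)
      = (\<Sum>a\<in>Obj A. l a * of_nat (card (Hom A a (as ! j))))" if "j < length as" for j
    using that v
    by (simp add: hom_matrix_def scalar_prod_def lessThan_atLeast0[symmetric] l
        obj_enum_sum[OF as, of "\<lambda>a. l a * of_nat (card (Hom A a (as ! j)))"])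
  have "coweighting (hom_matrix A as) v
      \<longleftrightarrow> (\<forall>j<length as. (v * hom_matrix A as) $$ (0, j) = 1)"
    using v by (auto simp: coweighting_def hom_matrix_def ones_def mat_eq_iff simp del: index_mult_mat(1))
  also have "\<dots> \<longleftrightarrow> (\<forall>j<length as. (\<Sum>a\<in>Obj A. l a * of_nat (card (Hom A a (as ! j)))) = 1)"
    using col by simp
  also have "\<dots> \<longleftrightarrow> obj_coweighting A l"
    unfolding obj_coweighting_def by (rule obj_enum_all[OF as])
  finally show ?thesis .
qed

text \<open>
  Functions on objects are the intermediate step by which a weighting or coweighting for one
  enumeration of the objects yields one for every other enumeration.
\<close>

lemma weighting_to_obj:
  assumes as: "obj_enum A as" and w: "weighting (hom_matrix A as) w"
  obtains k where "obj_weighting A k" and "\<And>i. i < length as \<Longrightarrow> w $$ (i, 0) = k (as ! i)"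
proof -
  obtain p where p: "\<And>i. i < length as \<Longrightarrow> p (as ! i) = i"
    using obj_enum_inverse[OF as] by blast
  have wc: "w \<in> carrier_mat (length as) 1"
    using w by (simp add: weighting_def hom_matrix_def)
  show thesis
    using weighting_hom_matrix_iff[OF as wc, of "\<lambda>a. w $$ (p a, 0)"] w p
    by (intro that[of "\<lambda>a. w $$ (p a, 0)"]) auto
qed

lemma coweighting_to_obj:
  assumes as: "obj_enum A as" and v: "coweighting (hom_matrix A as) v"
  obtains l where "obj_coweighting A l"
proof -
  obtain p where p: "\<And>i. i < length as \<Longrightarrow> p (as ! i) = i"
    using obj_enum_inverse[OF as] by blast
  have vc: "v \<in> carrier_mat 1 (length as)"
    using v by (simp add: coweighting_def hom_matrix_def)
  show thesis
    using coweighting_hom_matrix_iff[OF as vc, of "\<lambda>a. v $$ (0, p a)"] v p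
    by (intro that[of "\<lambda>a. v $$ (0, p a)"]) auto
qed

lemma weighting_of_obj:
  assumes "obj_enum A as" and "obj_weighting A k"
  shows "weighting (hom_matrix A as) (mat (length as) 1 (\<lambda>(i, _). k (as ! i)))"
  using assms by (subst weighting_hom_matrix_iff[where k = k]) auto

lemma coweighting_of_obj:
  assumes "obj_enum A as" and "obj_coweighting A l"
  shows "coweighting (hom_matrix A as) (mat 1 (length as) (\<lambda>(_, i). l (as ! i)))"
  using assms by (subst coweighting_hom_matrix_iff[where l = l]) auto

section \<open>Comparison of the Euler characteristics\<close>

lemma weighting_sum_eq_coweighting_sum:
  assumes as: "obj_enum A as" and w: "weighting (hom_matrix A as) w" and l: "obj_coweighting A l"
  shows "(transpose_mat (ones (card (Obj A))) * w) $$ (0, 0) = (\<Sum>a\<in>Obj A. l a)"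
proof -
  obtain k where k: "obj_weighting A k"
    and wk: "\<And>i. i < length as \<Longrightarrow> w $$ (i, 0) = k (as ! i)"
    using weighting_to_obj[OF as w] by blast
  have "w \<in> carrier_mat (length as) 1"
    using w by (simp add: weighting_def hom_matrix_def)
  then have "(transpose_mat (ones (card (Obj A))) * w) $$ (0, 0) = (\<Sum>i<length as. k (as ! i))"
    by (simp add: ones_def scalar_prod_def lessThan_atLeast0[symmetric] wk
        obj_enum_length[OF as, symmetric])
  also have "\<dots> = (\<Sum>a\<in>Obj A. k a)"
    by (rule obj_enum_sum[OF as])
  also have "\<dots> = (\<Sum>a\<in>Obj A. l a)"
    by (rule obj_weighting_sum_eq_coweighting_sum[OF k l])
  finally show ?thesis .
qed

theorem theorem2p6:
  fixes A :: "('o, 'a) cat_data"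
  assumes "finite_category A"
    and "leinster_defined A"
  shows "leinster_char A = euler_char A"
proof -
  obtain as w v where as: "obj_enum A as" and w: "weighting (hom_matrix A as) w"
    and v: "coweighting (hom_matrix A as) v"
    using assms(2) by (auto simp: leinster_defined_def)
  obtain k where k: "obj_weighting A k"
    using weighting_to_obj[OF as w] by blast
  obtain l where l: "obj_coweighting A l"
    using coweighting_to_obj[OF as v] by blast
  have "leinster_char A = (\<Sum>a\<in>Obj A. l a)"
    unfolding leinster_char_def
    using as w weighting_sum_eq_coweighting_sum[OF _ _ l] by (intro the_equality) force+
  moreover have "(transpose_mat (ones (card (Obj A))) * moore_penrose (hom_matrix A bs)
      * ones (card (Obj A))) $$ (0, 0) = (\<Sum>a\<in>Obj A. l a)" if bs: "obj_enum A bs" for bs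
    using moore_penrose_sum_eq_weighting_sum[OF hom_matrix_carrier
        weighting_of_obj[OF bs k] coweighting_of_obj[OF bs l]]
      weighting_sum_eq_coweighting_sum[OF bs weighting_of_obj[OF bs k] l]
    by (simp add: obj_enum_length[OF bs])
  then have "euler_char A = (\<Sum>a\<in>Obj A. l a)"
    unfolding euler_char_def using as by (intro the_equality) force+
  ultimately show ?thesis by simp
qed

end
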